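(* Let $n \ge 1$ and let $A \subseteq \mathbb{Z}_n \setminus \{0\}$ with $|A| = k$. Then there exists a subset $B \subseteq A$ with $|B| \ge (k+1)/2$ that admits an ordering $(b_1,\dots,b_m)$ whose partial sums $s_j = \sum_{i=1}^{j} b_i$ ($1 \le j \le m$, computed in $\mathbb{Z}_n$) are pairwise distinct.
   Formalization: The formal statement assumes k ≥ 1 (A nonempty); for A empty the claim is false, since B must be empty and 0 ≥ 1/2 fails. *)

theory Defs
  imports Main "HOL-Number_Theory.Residues"
begin

text \<open>
  Lists are indexed from 0, so the sum over \<open>i < j\<close> is the sum
  \<open>b\<^sub>1 + \<dots> + b\<^sub>j\<close> of the first \<open>j\<close> entries, taken in the ring \<open>R\<close>.
\<close>

definition partial_sum :: "('a, 'm) ring_scheme \<Rightarrow> 'a list \<Rightarrow> nat \<Rightarrow> 'a" where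
  "partial_sum R bs j = (\<Oplus>\<^bsub>R\<^esub>i\<in>{..<j}. bs ! i)"

end

theory Submission
  imports Defs
begin

text \<open>
  The ordering is built greedily. Suppose \<open>b\<^sub>1, \<dots>, b\<^sub>m\<close> have distinct partial sums. A further element
  \<open>b\<close> can be appended unless it is one of the \<open>m\<close> used elements or one of the \<open>m - 1\<close> differences
  \<open>s\<^sub>j - s\<^sub>m\<close> with \<open>1 \<le> j < m\<close>; the case \<open>j = m\<close> is excluded by \<open>b \<noteq> 0\<close>. So an extension exists as
  long as \<open>2m \<le> |A|\<close>, and the process reaches length \<open>\<lfloor>|A|/2\<rfloor> + 1\<close>.
\<close>

context abelian_group
begin

lemma partial_sum_closed:
  assumes "set bs \<subseteq> carrier G" "j \<le> length bs"
  shows "partial_sum G bs j \<in> carrier G"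
  unfolding partial_sum_def using assms by (intro finsum_closed) (auto simp: subset_iff)

lemma partial_sum_append:
  assumes "set bs \<subseteq> carrier G" "j \<le> length bs"
  shows "partial_sum G (bs @ cs) j = partial_sum G bs j"
  unfolding partial_sum_def using assms
  by (intro finsum_cong') (auto simp: nth_append subset_iff)

lemma partial_sum_snoc:
  assumes "set bs \<subseteq> carrier G" "b \<in> carrier G"
  shows "partial_sum G (bs @ [b]) (Suc (length bs)) = partial_sum G bs (length bs) \<oplus> b"
proof -
  have "partial_sum G (bs @ [b]) (Suc (length bs)) = b \<oplus> partial_sum G (bs @ [b]) (length bs)"
    unfolding partial_sum_def lessThan_Suc using assms
    by (subst finsum_insert) (auto simp: nth_append subset_iff)
  then show ?thesis
    using assms partial_sum_append[of bs "length bs" "[b]"] partial_sum_closed[of bs "length bs"]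
    by (simp add: a_comm)
qed

lemma extend_distinct_partial_sums:
  assumes A: "A \<subseteq> carrier G - {\<zero>}" "finite A" "A \<noteq> {}"
    and bs: "set bs \<subseteq> A" "inj_on (partial_sum G bs) {1..length bs}"
    and len: "2 * length bs \<le> card A"
  obtains b where "b \<in> A - set bs" "inj_on (partial_sum G (bs @ [b])) {1..Suc (length bs)}"
proof -
  define m where "m = length bs"
  let ?s = "partial_sum G bs"
  \<comment> \<open>The forbidden values. Excluding \<open>set bs\<close> keeps the entries
    distinct, which distinct partial sums alone do not ensure. Index 0 is left out because a partial
    sum may equal the empty sum.\<close>
  define F where "F = set bs \<union> (\<lambda>j. ?s j \<ominus> ?s m) ` {1..<m}"
  have "card F \<le> m + (m - 1)"
    unfolding F_def m_def
    by (rule order.trans[OF card_Un_le add_mono[OF card_length order.trans[OF card_image_le]]]) auto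
  \<comment> \<open>For \<open>m = 0\<close> the left side is 0 and \<open>A\<close> is nonempty;
    otherwise it is \<open>2 * m - 1\<close>, below \<open>2 * m \<le> card A\<close>.\<close>
  also have "\<dots> < card A"
    using len A by (cases m) (auto simp: m_def card_gt_0_iff)
  finally have "\<not> A \<subseteq> F"
    using card_mono[of F A] by (auto simp: F_def)
  then obtain b where b: "b \<in> A" "b \<notin> F" by blast
  have carr: "set bs \<subseteq> carrier G" "b \<in> carrier G" "b \<noteq> \<zero>"
    using A bs b by auto
  have s: "?s j \<in> carrier G" if "j \<le> m" for j
    using partial_sum_closed carr that by (simp add: m_def)
  have new: "?s m \<oplus> b \<noteq> ?s j" if j: "j \<in> {1..m}" for j
  proof
    assume eq: "?s m \<oplus> b = ?s j"
    \<comment> \<open>Cancelling \<open>?s m\<close> turns a collision into a difference of the form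
      collected in \<open>F\<close>, or into zero when \<open>j = m\<close>.\<close>
    have "b = (?s m \<oplus> b) \<ominus> ?s m"
      using s[of m] carr by (simp add: a_minus_def a_comm[of "?s m" b] a_assoc r_neg)
    then have b_eq: "b = ?s j \<ominus> ?s m" by (simp only: eq)
    show False
    proof (cases "j = m")
      case True
      then show False using b_eq carr s[of m] by (simp add: a_minus_def r_neg)
    next
      case False
      then show False using b_eq b(2) j by (auto simp: F_def)
    qed
  qed
  \<comment> \<open>Appending leaves the earlier sums unchanged, so only the last sum has to be
    compared with the others.\<close>
  have old: "partial_sum G (bs @ [b]) j = ?s j" if "j \<in> {1..m}" for j
    using partial_sum_append carr that by (simp add: m_def)
  have "inj_on (partial_sum G (bs @ [b])) {1..m}"
    using bs(2) old inj_on_cong unfolding m_def by metis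
  moreover have "partial_sum G (bs @ [b]) (Suc m) = ?s m \<oplus> b"
    using partial_sum_snoc carr by (simp add: m_def)
  ultimately have "inj_on (partial_sum G (bs @ [b])) (insert (Suc m) {1..m})"
    using new old by (fastforce simp: inj_on_insert)
  moreover have "insert (Suc m) {1..m} = {1..Suc m}" by auto
  ultimately have "inj_on (partial_sum G (bs @ [b])) {1..Suc (length bs)}"
    by (simp only: m_def)
  moreover have "b \<in> A - set bs"
    using b by (simp add: F_def)
  ultimately show thesis
    by (rule that[rotated])
qed

lemma exists_distinct_partial_sums:
  assumes "A \<subseteq> carrier G - {\<zero>}" "finite A" "A \<noteq> {}" "m \<le> card A div 2 + 1"
  shows "\<exists>bs. distinct bs \<and> set bs \<subseteq> A \<and> length bs = m \<and> inj_on (partial_sum G bs) {1..m}"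
  using assms(4)
proof (induction m)
  case 0
  show ?case by auto
next
  case (Suc m)
  then obtain bs where bs: "distinct bs" "set bs \<subseteq> A" "length bs = m"
      "inj_on (partial_sum G bs) {1..m}"
    by auto
  \<comment> \<open>The bound on \<open>Suc m\<close> gives \<open>m \<le> card A div 2\<close>,
    exactly what one more extension requires.\<close>
  moreover have "2 * length bs \<le> card A"
    using Suc.prems bs(3) by simp
  ultimately obtain b where "b \<in> A - set bs" "inj_on (partial_sum G (bs @ [b])) {1..Suc m}"
    using extend_distinct_partial_sums[OF assms(1-3), of bs] by metis
  with bs show ?case by (intro exI[of _ "bs @ [b]"]) auto
qed

end

theorem theorem4:
  fixes n k :: nat and A :: "int set"
  assumes "n \<ge> 1"
    and "A \<subseteq> carrier (residue_ring (int n)) - {\<zero>\<^bsub>residue_ring (int n)\<^esub>}"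
    and "card A = k"
    and "k \<ge> 1"
  shows "\<exists>B\<subseteq>A. real (card B) \<ge> (real k + 1) / 2 \<and>
           (\<exists>bs. distinct bs \<and> set bs = B \<and>
              inj_on (partial_sum (residue_ring (int n)) bs) {1..length bs})"
proof -
  have A: "finite A" "A \<noteq> {}"
    using assms(3,4) card_gt_0_iff[of A] by auto
  \<comment> \<open>The locale \<open>residues\<close> needs a modulus above 1. For modulus 1 the
    carrier is just zero, which would leave \<open>A\<close> empty.\<close>
  have "n \<noteq> 1"
    using A(2) assms(2) by (auto simp: residue_ring_def)
  then interpret residues "int n" "residue_ring (int n)"
    using assms(1) by unfold_locales auto
  obtain bs where bs: "distinct bs" "set bs \<subseteq> A" "length bs = k div 2 + 1"
      "inj_on (partial_sum (residue_ring (int n)) bs) {1..k div 2 + 1}"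
    using exists_distinct_partial_sums[OF assms(2) A, of "k div 2 + 1"] assms(3) by auto
  \<comment> \<open>\<open>k div 2 + 1\<close> equals \<open>(k + 1) / 2\<close> for odd
    \<open>k\<close> and exceeds it by 1/2 for even \<open>k\<close>.\<close>
  have "real (card (set bs)) \<ge> (real k + 1) / 2"
    using bs(1,3) by (simp add: distinct_card)
  with bs show ?thesis by (intro exI[of _ "set bs"]) auto
qed

end
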